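(* Let $\theta_{i1}=(\theta_{i1}^x,\theta_{i1}^y)$ and $\theta_{i2}=(\theta_{i2}^x,\theta_{i2}^y,\theta_{i2}^{xy})$, $i=1,\dots,n$, be realizations of the internal means and internal variances/covariance of $n$ pairs of interval-valued observations, and consider the likelihood $$L(\tau)=\prod_{i=1}^n g_1(\theta_{i1}^x,\theta_{i1}^y;\mu_x,\mu_y,\sigma_x^2,\sigma_y^2,\rho)\; g_2(\theta_{i2}^x,\theta_{i2}^y,\theta_{i2}^{xy};\gamma_1,\gamma_2,\gamma_3),\qquad \tau=(\mu_x,\mu_y,\sigma_x^2,\sigma_y^2,\rho,\gamma_1,\gamma_2,\gamma_3),$$ where $g_1$ is the bivariate normal density and $g_2$ the bivariate Wishart density with $\nu>2$ degrees of freedom (see context). Then the maximum likelihood estimators of the components of $\tau$ are $$\hat\mu_x=\frac1n\sum_{i=1}^n\theta_{i1}^x,\quad \hat\mu_y=\frac1n\sum_{i=1}^n\theta_{i1}^y,\quad \hat\sigma_x^2=\frac1n\sum_{i=1}^n(\theta_{i1}^x-\hat\mu_x)^2,\quad \hat\sigma_y^2=\frac1n\sum_{i=1}^n(\theta_{i1}^y-\hat\mu_y)^2,$$ $$\hat\rho=\frac{\sum_{i=1}^n(\theta_{i1}^y-\hat\mu_y)(\theta_{i1}^x-\hat\mu_x)}{\left(\sum_{i=1}^n(\theta_{i1}^y-\hat\mu_y)^2\sum_{i=1}^n(\theta_{i1}^x-\hat\mu_x)^2\right)^{1/2}},$$ $$\hat\gamma_1=\frac1{n\nu}\sum_{i=1}^n\theta_{i2}^x,\quad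 \hat\gamma_2=\frac1{n\nu}\sum_{i=1}^n\theta_{i2}^y,\quad \hat\gamma_3=\frac1{n\nu}\sum_{i=1}^n\theta_{i2}^{xy}.$$ That is, $\hat\rho=\hat\sigma_{xy}/(\hat\sigma_x\hat\sigma_y)$, where $\sigma_{xy}=\mathrm{Cov}(\Theta_1^x,\Theta_1^y)$ is the covariance of the internal means, and hence the estimator of this covariance is $$\hat\sigma_{xy}=\frac1n\sum_{i=1}^n(\theta_{i1}^y-\hat\mu_y)(\theta_{i1}^x-\hat\mu_x).$$
   Context: The parameters are those of the two densities: $\mu_x,\mu_y$ real, $\sigma_x,\sigma_y>0$, $|\rho|<1$, $\gamma_1,\gamma_2>0$, $\gamma_1\gamma_2>\gamma_3^2$; the degrees of freedom $\nu$ are fixed and not estimated. $g_1$ is the bivariate normal density with means $\mu_x,\mu_y$, variances $\sigma_x^2,\sigma_y^2$ and correlation $\rho$; it is the density of the random internal means $(\Theta_{i1}^x,\Theta_{i1}^y)$. $g_2$ is the bivariate Wishart density of the random internal variances and covariance $(\Theta_{i2}^x,\Theta_{i2}^y,\Theta_{i2}^{xy})$: for $s>0$, $t>0$, $-\sqrt{st}<r<\sqrt{st}$, $$g_2(s,t,r;\gamma_1,\gamma_2,\gamma_3)=\frac{(\gamma_1\gamma_2-\gamma_3^2)^{-\nu/2}}{2^\nu\sqrt{\pi}\,\Gamma(\frac{\nu}{2})\Gamma(\frac{\nu-1}{2})}(st-r^2)^{\frac{\nu-3}{2}}\exp\left\{-\frac{\gamma_1\gamma_2}{2(\gamma_1\gamma_2-\gamma_3^2)}\left(\frac{s}{\gamma_1}+\frac{t}{\gamma_2}-\frac{2\gamma_3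 r}{\gamma_1\gamma_2}\right)\right\}.$$
   Formalization: That the stated estimators maximize the likelihood is asserted only when the points (θ_{i1}^x, θ_{i1}^y) are not collinear; for collinear points (e.g. n = 1, where ρ̂ is 0/0) no maximum likelihood estimator exists. *)

theory Defs
  imports "HOL-Probability.Probability"
begin

record params =
  mu_x :: real
  mu_y :: real
  var_x :: real
  var_y :: real
  rho :: real
  gamma1 :: real
  gamma2 :: real
  gamma3 :: real

definition param_space :: "params set" where
  "param_space = {\<tau>. var_x \<tau> > 0 \<and> var_y \<tau> > 0 \<and> \<bar>rho \<tau>\<bar> < 1 \<and>
     gamma1 \<tau> > 0 \<and> gamma2 \<tau> > 0 \<and> gamma1 \<tau> * gamma2 \<tau> > (gamma3 \<tau>)\<^sup>2}"

text \<open>The bivariate normal density is parametrised by the variances \<open>vx = \<sigma>\<^sub>x\<^sup>2\<close> and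
  \<open>vy = \<sigma>\<^sub>y\<^sup>2\<close>, not by the standard deviations.\<close>

definition g1 :: "real \<Rightarrow> real \<Rightarrow> real \<Rightarrow> real \<Rightarrow> real \<Rightarrow> real \<Rightarrow> real \<Rightarrow> real" where
  "g1 x y mx my vx vy \<rho> =
     1 / (2 * pi * sqrt vx * sqrt vy * sqrt (1 - \<rho>\<^sup>2)) *
     exp (- (1 / (2 * (1 - \<rho>\<^sup>2))) *
        ((x - mx)\<^sup>2 / vx - 2 * \<rho> * (x - mx) * (y - my) / (sqrt vx * sqrt vy) + (y - my)\<^sup>2 / vy))"

definition wishart_support :: "(real \<times> real \<times> real) set" where
  "wishart_support = {(s, t, r). s > 0 \<and> t > 0 \<and> - sqrt (s * t) < r \<and> r < sqrt (s * t)}"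

definition g2 :: "real \<Rightarrow> real \<Rightarrow> real \<Rightarrow> real \<Rightarrow> real \<Rightarrow> real \<Rightarrow> real \<Rightarrow> real" where
  "g2 \<nu> s t r c1 c2 c3 =
     (if (s, t, r) \<in> wishart_support then
        (c1 * c2 - c3\<^sup>2) powr (- \<nu> / 2) /
          (2 powr \<nu> * sqrt pi * Gamma (\<nu> / 2) * Gamma ((\<nu> - 1) / 2)) *
        (s * t - r\<^sup>2) powr ((\<nu> - 3) / 2) *
        exp (- (c1 * c2 / (2 * (c1 * c2 - c3\<^sup>2))) *
           (s / c1 + t / c2 - 2 * c3 * r / (c1 * c2)))
      else 0)"

text \<open>Throughout, \<open>x, y\<close> are the realised internal means \<open>\<theta>\<^sub>1\<^sup>x, \<theta>\<^sub>1\<^sup>y\<close> and \<open>s, t, r\<close> the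
  realised internal variances and covariance \<open>\<theta>\<^sub>2\<^sup>x, \<theta>\<^sub>2\<^sup>y, \<theta>\<^sub>2\<^sup>x\<^sup>y\<close>, with sample index \<open>1..n\<close>.\<close>

definition likelihood ::
  "real \<Rightarrow> nat \<Rightarrow> (nat \<Rightarrow> real) \<Rightarrow> (nat \<Rightarrow> real) \<Rightarrow> (nat \<Rightarrow> real) \<Rightarrow> (nat \<Rightarrow> real) \<Rightarrow> (nat \<Rightarrow> real)
    \<Rightarrow> params \<Rightarrow> real" where
  "likelihood \<nu> n x y s t r \<tau> =
     (\<Prod>i=1..n. g1 (x i) (y i) (mu_x \<tau>) (mu_y \<tau>) (var_x \<tau>) (var_y \<tau>) (rho \<tau>) *
                g2 \<nu> (s i) (t i) (r i) (gamma1 \<tau>) (gamma2 \<tau>) (gamma3 \<tau>))"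

definition is_mle ::
  "real \<Rightarrow> nat \<Rightarrow> (nat \<Rightarrow> real) \<Rightarrow> (nat \<Rightarrow> real) \<Rightarrow> (nat \<Rightarrow> real) \<Rightarrow> (nat \<Rightarrow> real) \<Rightarrow> (nat \<Rightarrow> real)
    \<Rightarrow> params \<Rightarrow> bool" where
  "is_mle \<nu> n x y s t r \<tau> \<longleftrightarrow>
     is_arg_max (likelihood \<nu> n x y s t r) (\<lambda>\<tau>'. \<tau>' \<in> param_space) \<tau>"

definition covariance :: "'a measure \<Rightarrow> ('a \<Rightarrow> real) \<Rightarrow> ('a \<Rightarrow> real) \<Rightarrow> real" where
  "covariance M X Y =
     (LINT \<omega>|M. (X \<omega> - (LINT \<omega>'|M. X \<omega>')) * (Y \<omega> - (LINT \<omega>'|M. Y \<omega>')))"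

definition internal_means_distr :: "params \<Rightarrow> (real \<times> real) measure" where
  "internal_means_distr \<tau> = density lborel
     (\<lambda>(x, y). ennreal (g1 x y (mu_x \<tau>) (mu_y \<tau>) (var_x \<tau>) (var_y \<tau>) (rho \<tau>)))"

definition sigma_xy :: "params \<Rightarrow> real" where
  "sigma_xy \<tau> = covariance (internal_means_distr \<tau>) fst snd"

definition sample_mean :: "nat \<Rightarrow> (nat \<Rightarrow> real) \<Rightarrow> real" where
  "sample_mean n x = 1 / real n * (\<Sum>i=1..n. x i)"

definition sigma_xy_hat :: "nat \<Rightarrow> (nat \<Rightarrow> real) \<Rightarrow> (nat \<Rightarrow> real) \<Rightarrow> real" where
  "sigma_xy_hat n x y =
     1 / real n * (\<Sum>i=1..n. (y i - sample_mean n y) * (x i - sample_mean n x))"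

definition tau_hat ::
  "real \<Rightarrow> nat \<Rightarrow> (nat \<Rightarrow> real) \<Rightarrow> (nat \<Rightarrow> real) \<Rightarrow> (nat \<Rightarrow> real) \<Rightarrow> (nat \<Rightarrow> real) \<Rightarrow> (nat \<Rightarrow> real)
    \<Rightarrow> params" where
  "tau_hat \<nu> n x y s t r =
     \<lparr> mu_x = sample_mean n x,
       mu_y = sample_mean n y,
       var_x = 1 / real n * (\<Sum>i=1..n. (x i - sample_mean n x)\<^sup>2),
       var_y = 1 / real n * (\<Sum>i=1..n. (y i - sample_mean n y)\<^sup>2),
       rho = (\<Sum>i=1..n. (y i - sample_mean n y) * (x i - sample_mean n x)) /
             sqrt ((\<Sum>i=1..n. (y i - sample_mean n y)\<^sup>2) * (\<Sum>i=1..n. (x i - sample_mean n x)\<^sup>2)),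
       gamma1 = 1 / (real n * \<nu>) * (\<Sum>i=1..n. s i),
       gamma2 = 1 / (real n * \<nu>) * (\<Sum>i=1..n. t i),
       gamma3 = 1 / (real n * \<nu>) * (\<Sum>i=1..n. r i) \<rparr>"

end

theory Submission
  imports Defs
begin

text \<open>
  Up to constants, both densities are \<open>exp\<close> of \<open>- 1/2\<close> times a positive multiple of
  \<open>ln det \<Sigma> + tr (\<Sigma>\<^sup>-\<^sup>1 A)\<close>: for the normal part \<open>\<Sigma>\<close> is the covariance matrix, for the Wishart
  part it is the matrix of the \<open>\<gamma>\<close>s. This function is affine in \<open>A\<close>, so the sample enters the
  likelihood only through averages. For positive definite \<open>A\<close> its unique minimiser over positive
  definite \<open>\<Sigma>\<close> is \<open>\<Sigma> = A\<close>, by \<open>tr B \<ge> 2 sqrt (det B)\<close> for \<open>B = \<Sigma>\<^sup>-\<^sup>1 A\<close> and \<open>ln w \<le> w - 1\<close>. For singular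
  \<open>A\<close> (collinear internal means) it is unbounded below along \<open>\<Sigma> = A + \<epsilon> I\<close>, so that no maximum
  likelihood estimate exists.
\<close>

section \<open>Minimising \<open>ln det + tr\<close> over positive definite 2 by 2 matrices\<close>

text \<open>\<open>ln det \<Sigma> + tr (\<Sigma>\<^sup>-\<^sup>1 A)\<close> for the symmetric matrices \<open>\<Sigma>\<close> and \<open>A\<close> with diagonals \<open>(a, b)\<close>, \<open>(A, B)\<close>
  and off-diagonal entries \<open>c\<close>, \<open>C\<close>.\<close>

definition gauss_dev :: "real \<Rightarrow> real \<Rightarrow> real \<Rightarrow> real \<Rightarrow> real \<Rightarrow> real \<Rightarrow> real" where
  "gauss_dev a b c A B C = ln (a * b - c\<^sup>2) + (a * B + b * A - 2 * c * C) / (a * b - c\<^sup>2)"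

text \<open>The bracket on the left is the discriminant in z of det (A - z \<Sigma>), whose roots
  are the eigenvalues of \<Sigma>^(-1) A. For positive definite \<Sigma> the right-hand side is a
  sum of squares, which yields the trace inequality together with its equality case.\<close>

lemma mixed_det_identity:
  fixes a b c A B C :: real
  shows "a\<^sup>2 * ((a * B + b * A - 2 * c * C)\<^sup>2 - 4 * (a * b - c\<^sup>2) * (A * B - C\<^sup>2)) =
    (a * (a * B - b * A) - 2 * c * (a * C - c * A))\<^sup>2 + 4 * (a * b - c\<^sup>2) * (a * C - c * A)\<^sup>2"
  by algebra

text \<open>Multiplying the two determinant conditions bounds \<open>(c * C)\<^sup>2\<close> by
  \<open>(a * B) * (b * A)\<close>; the rest is the inequality of arithmetic and geometric
  means.\<close>

lemma mixed_det_pos: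
  fixes a b c A B C :: real
  assumes "a > 0" "b > 0" "c\<^sup>2 < a * b" "A > 0" "B > 0" "C\<^sup>2 < A * B"
  shows "a * B + b * A - 2 * c * C > 0"
proof -
  have "(c * C)\<^sup>2 < (a * b) * (A * B)"
    using mult_strict_mono'[OF assms(3,6)] by (simp add: power_mult_distrib)
  then have "(2 * (c * C))\<^sup>2 < 4 * (a * B) * (b * A)"
    by (simp add: power_mult_distrib mult_ac)
  also have "\<dots> \<le> (a * B + b * A)\<^sup>2"
    using zero_le_power2[of "a * B - b * A"] by (simp add: power2_eq_square algebra_simps)
  finally have "2 * (c * C) < a * B + b * A"
    by (rule power2_less_imp_less) (use assms in \<open>auto intro!: add_nonneg_nonneg\<close>)
  then show ?thesis by simp
qed

lemma gauss_dev_self: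
  assumes "C\<^sup>2 < A * B"
  shows "gauss_dev A B C A B C = ln (A * B - C\<^sup>2) + 2"
proof -
  have tr: "A * B + B * A - 2 * C * C = 2 * (A * B - C\<^sup>2)"
    by (simp add: power2_eq_square)
  have "2 * (A * B - C\<^sup>2) / (A * B - C\<^sup>2) = 2"
    using assms by (intro nonzero_mult_div_cancel_right) simp
  then show ?thesis unfolding gauss_dev_def tr by simp
qed

text \<open>The difference of the two sides is \<open>T / d - 2 - 2 * ln w\<close>, which is at
  least \<open>2 * (w - 1 - ln w)\<close> and so nonnegative. Equality forces \<open>w = 1\<close>
  and a vanishing discriminant; the latter makes the two matrices proportional.\<close>

lemma gauss_dev_ge:
  assumes ab: "a > 0" "b > 0" "c\<^sup>2 < a * b" and AB: "A > 0" "B > 0" "C\<^sup>2 < A * B"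
  shows "gauss_dev A B C A B C \<le> gauss_dev a b c A B C"
    and "gauss_dev a b c A B C \<le> gauss_dev A B C A B C \<Longrightarrow> a = A \<and> b = B \<and> c = C"
proof -
  define d D T where "d = a * b - c\<^sup>2" and "D = A * B - C\<^sup>2" and "T = a * B + b * A - 2 * c * C"
  \<comment> \<open>\<open>T / d\<close> and \<open>w\<^sup>2\<close> are the trace and the
    determinant of \<Sigma>^(-1) A.\<close>
  define w where "w = sqrt (D / d)"
  have d: "d > 0" and D: "D > 0" and T: "T > 0"
    using ab AB mixed_det_pos[OF ab AB] by (auto simp: d_def D_def T_def)
  have w: "w > 0" "w\<^sup>2 = D / d" using d D by (auto simp: w_def)
  have id: "a\<^sup>2 * (T\<^sup>2 - 4 * d * D) =
      (a * (a * B - b * A) - 2 * c * (a * C - c * A))\<^sup>2 + 4 * d * (a * C - c * A)\<^sup>2"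
    unfolding T_def d_def D_def by (rule mixed_det_identity)
  have "0 \<le> a\<^sup>2 * (T\<^sup>2 - 4 * d * D)" unfolding id using d by simp
  then have "4 * d * D \<le> T\<^sup>2" using ab by (simp add: zero_le_mult_iff)
  then have "(2 * w)\<^sup>2 \<le> (T / d)\<^sup>2"
    unfolding power_mult_distrib power_divide w(2) using d
    by (simp add: divide_simps power2_eq_square mult_ac)
  then have amgm: "2 * w \<le> T / d"
    by (rule power2_le_imp_le) (use T d in auto)
  have lnw: "ln D = ln d + 2 * ln w"
  proof -
    have "D = d * w\<^sup>2" using d by (simp add: w(2))
    then have "ln D = ln d + ln (w\<^sup>2)" using d w(1) by (simp add: ln_mult_pos)
    then show ?thesis using w(1) by (simp add: ln_realpow)
  qed
  have dev: "gauss_dev a b c A B C - gauss_dev A B C A B C = T / d - 2 - 2 * ln w"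
    using lnw AB by (simp add: gauss_dev_self) (simp add: gauss_dev_def d_def D_def T_def)
  have ln1: "ln w \<le> w - 1" using w by (simp add: ln_le_minus_one)
  show "gauss_dev A B C A B C \<le> gauss_dev a b c A B C"
    using dev amgm ln1 by linarith
  assume "gauss_dev a b c A B C \<le> gauss_dev A B C A B C"
  then have "ln w = w - 1" and Tw: "T / d = 2 * w" using dev amgm ln1 by linarith+
  then have w1: "w = 1" using w ln_eq_minus_one by blast
  then have Dd: "D = d" using w d by simp
  have "T\<^sup>2 - 4 * d * D = 0" using Tw w1 Dd d by (simp add: field_simps power2_eq_square)
  then have z: "(a * (a * B - b * A) - 2 * c * (a * C - c * A))\<^sup>2 + 4 * d * (a * C - c * A)\<^sup>2 = 0"
    using id by simp
  have "0 \<le> 4 * d * (a * C - c * A)\<^sup>2" using d by simp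
  then have "4 * d * (a * C - c * A)\<^sup>2 = 0"
    and z2: "(a * (a * B - b * A) - 2 * c * (a * C - c * A))\<^sup>2 = 0"
    using z zero_le_power2[of "a * (a * B - b * A) - 2 * c * (a * C - c * A)"] by linarith+
  then have q: "a * C = c * A" using d by simp
  then have p: "a * B = b * A" using z2 ab by simp
  have "T = 2 * d" using Tw w1 d by (simp add: field_simps)
  \<comment> \<open>Comparing two values of \<open>a * T\<close> shows that the factor of
    proportionality \<open>A / a\<close> is 1.\<close>
  then have "a * T = 2 * a * d" by simp
  also have "a * T = 2 * A * d"
  proof -
    have "a * T = a * (a * B) + a * b * A - 2 * c * (a * C)" by (simp add: T_def algebra_simps)
    also have "\<dots> = 2 * A * d" unfolding p q by (simp add: d_def power2_eq_square algebra_simps)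
    finally show ?thesis .
  qed
  finally have "a = A" using d by simp
  then show "a = A \<and> b = B \<and> c = C" using p q ab by simp
qed

text \<open>For v = (p, q), adding the rank-one matrix v v^T to A adds the positive definite
  quadratic form v^T \<Sigma>^(-1) v, here \<open>Q / d\<close>. This is the cost of a mean
  parameter that differs from the sample mean.\<close>

lemma gauss_dev_shift:
  assumes ab: "a > 0" "c\<^sup>2 < a * b"
  shows "gauss_dev a b c A B C \<le> gauss_dev a b c (A + p\<^sup>2) (B + q\<^sup>2) (C + p * q)"
    and "gauss_dev a b c (A + p\<^sup>2) (B + q\<^sup>2) (C + p * q) \<le> gauss_dev a b c A B C \<Longrightarrow> p = 0 \<and> q = 0"
proof -
  define d where "d = a * b - c\<^sup>2"
  have d: "d > 0" using ab by (simp add: d_def)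
  define Q where "Q = a * q\<^sup>2 + b * p\<^sup>2 - 2 * c * (p * q)"
  \<comment> \<open>The factor \<open>a\<close> completes the square in \<open>q\<close>.\<close>
  have aQ: "a * Q = (a * q - c * p)\<^sup>2 + d * p\<^sup>2"
    by (simp add: Q_def d_def power2_eq_square algebra_simps)
  then have "0 \<le> a * Q" using d by simp
  then have Q: "0 \<le> Q" using ab by (simp add: zero_le_mult_iff)
  have e: "gauss_dev a b c (A + p\<^sup>2) (B + q\<^sup>2) (C + p * q) = gauss_dev a b c A B C + Q / d"
    unfolding gauss_dev_def d_def[symmetric] Q_def
    by (simp add: algebra_simps add_divide_distrib diff_divide_distrib)
  show "gauss_dev a b c A B C \<le> gauss_dev a b c (A + p\<^sup>2) (B + q\<^sup>2) (C + p * q)"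
    using e Q d by simp
  assume "gauss_dev a b c (A + p\<^sup>2) (B + q\<^sup>2) (C + p * q) \<le> gauss_dev a b c A B C"
  then have "Q / d \<le> 0" using e by simp
  then have "Q = 0" using Q d by (simp add: divide_le_0_iff)
  then have *: "(a * q - c * p)\<^sup>2 + d * p\<^sup>2 = 0" using aQ by simp
  moreover have "0 \<le> d * p\<^sup>2" using d by simp
  ultimately have "d * p\<^sup>2 = 0" using zero_le_power2[of "a * q - c * p"] by linarith
  then have "p = 0" using d by simp
  then show "p = 0 \<and> q = 0" using * ab by simp
qed

text \<open>At \<Sigma> = A + e I the determinant is \<open>e * (A + B) + e\<^sup>2\<close>, which
  tends to 0 with \<open>e\<close>, while the trace term stays below 1.\<close>

lemma gauss_dev_unbounded_below:
  assumes "A \<ge> 0" "B \<ge> 0" "A * B = C\<^sup>2"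
  obtains a b c where "a > 0" "b > 0" "c\<^sup>2 < a * b" "gauss_dev a b c A B C < K"
proof -
  \<comment> \<open>Since \<open>e \<le> 1\<close>, the determinant is at most
    \<open>e * (A + B + 1)\<close>. The second entry of the minimum pushes this below
    \<open>exp (K - 1)\<close>, leaving 1 for the trace term.\<close>
  define e where "e = min 1 (exp (K - 1) / (2 * (A + B + 1)))"
  have e: "e > 0" "e \<le> 1" using assms by (auto simp: e_def)
  define d where "d = e * (A + B) + e\<^sup>2"
  have d: "d > 0" using e assms by (simp add: d_def add_nonneg_pos)
  have det: "(A + e) * (B + e) - C\<^sup>2 = d"
    unfolding d_def assms(3)[symmetric] by (simp add: power2_eq_square algebra_simps)
  have tr: "(A + e) * B + (B + e) * A - 2 * C * C = e * (A + B)"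
  proof -
    have "2 * C * C = 2 * (A * B)" unfolding assms(3) by (simp add: power2_eq_square)
    then show ?thesis by (simp add: algebra_simps)
  qed
  have "e * (A + B) \<le> d" by (simp add: d_def)
  then have r: "e * (A + B) / d \<le> 1" using d by simp
  have "e * e \<le> e * 1" using e by (intro mult_left_mono) auto
  then have "d \<le> e * (A + B + 1)" by (simp add: d_def power2_eq_square algebra_simps)
  also have "\<dots> \<le> exp (K - 1) / (2 * (A + B + 1)) * (A + B + 1)"
    using assms by (intro mult_right_mono) (auto simp: e_def)
  also have "\<dots> = exp (K - 1) / 2" using assms by (simp add: field_simps)
  also have "\<dots> < exp (K - 1)" by simp
  finally have "ln d < K - 1" using d by (metis exp_gt_zero ln_exp ln_less_cancel_iff)
  then have "gauss_dev (A + e) (B + e) C A B C < K"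
    using r by (simp add: gauss_dev_def det tr)
  moreover have "C\<^sup>2 < (A + e) * (B + e)" using det d by simp
  ultimately show ?thesis
    using that[of "A + e" "B + e" C] assms e by simp
qed

section \<open>Densities and likelihood in terms of \<open>gauss_dev\<close>\<close>

text \<open>The off-diagonal entry of the covariance matrix, kept apart from the integral
  \<open>sigma_xy\<close>; the two are identified on \<open>param_space\<close> by
  \<open>sigma_xy_eq\<close>.\<close>

definition cov_param :: "params \<Rightarrow> real" where
  "cov_param \<tau> = rho \<tau> * sqrt (var_x \<tau>) * sqrt (var_y \<tau>)"

lemma cov_det:
  assumes "vx > 0" "vy > (0::real)"
  shows "vx * vy - (\<rho> * sqrt vx * sqrt vy)\<^sup>2 = vx * vy * (1 - \<rho>\<^sup>2)"
  using assms by (simp add: power_mult_distrib algebra_simps)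

lemma cov_param_less:
  assumes "\<tau> \<in> param_space"
  shows "(cov_param \<tau>)\<^sup>2 < var_x \<tau> * var_y \<tau>"
proof -
  have v: "var_x \<tau> > 0" "var_y \<tau> > 0" "(rho \<tau>)\<^sup>2 < 1"
    using assms by (auto simp: param_space_def abs_square_less_1)
  then have "0 < var_x \<tau> * var_y \<tau> * (1 - (rho \<tau>)\<^sup>2)" by simp
  then show ?thesis using cov_det[OF v(1,2), of "rho \<tau>"] by (simp add: cov_param_def)
qed

text \<open>With v = (x - mx, y - my), the exponent of the normal density is -1/2 times v^T
  \<Sigma>^(-1) v = tr (\<Sigma>^(-1) v v^T), and the logarithm of the determinant supplies the
  normalising factor.\<close>

lemma g1_gauss_dev:
  assumes "vx > 0" "vy > 0" "\<bar>\<rho>\<bar> < 1"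
  shows "g1 x y mx my vx vy \<rho> = 1 / (2 * pi) *
    exp (- (1 / 2) * gauss_dev vx vy (\<rho> * sqrt vx * sqrt vy) ((x - mx)\<^sup>2) ((y - my)\<^sup>2) ((x - mx) * (y - my)))"
proof -
  define d where "d = vx * vy * (1 - \<rho>\<^sup>2)"
  have r: "1 - \<rho>\<^sup>2 > 0" using assms by (simp add: abs_square_less_1)
  then have d: "d > 0" using assms by (simp add: d_def)
  \<comment> \<open>Writing the variances as squares removes the roots from the rational identity
    below.\<close>
  obtain p q where pq: "p > 0" "q > 0" "vx = p\<^sup>2" "vy = q\<^sup>2"
    using assms by (metis real_sqrt_gt_zero real_sqrt_pow2 less_imp_le)
  have "exp (- (1 / 2) * ln d) = 1 / sqrt d"
    using d by (simp add: exp_minus inverse_eq_divide flip: ln_sqrt)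
  also have "sqrt d = sqrt vx * sqrt vy * sqrt (1 - \<rho>\<^sup>2)" by (simp add: d_def real_sqrt_mult)
  finally have 1: "exp (- (1 / 2) * ln d) = 1 / (sqrt vx * sqrt vy * sqrt (1 - \<rho>\<^sup>2))" .
  have 2: "- (1 / 2) * ((vx * (y - my)\<^sup>2 + vy * (x - mx)\<^sup>2
       - 2 * (\<rho> * sqrt vx * sqrt vy) * ((x - mx) * (y - my))) / d) =
     - (1 / (2 * (1 - \<rho>\<^sup>2))) *
        ((x - mx)\<^sup>2 / vx - 2 * \<rho> * (x - mx) * (y - my) / (sqrt vx * sqrt vy) + (y - my)\<^sup>2 / vy)"
    using r pq(1,2) unfolding d_def pq(3,4)
    by (simp add: divide_simps) (simp add: power2_eq_square algebra_simps)
  show ?thesis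
    unfolding gauss_dev_def cov_det[OF assms(1,2)] d_def[symmetric] distrib_left exp_add 1 2 g1_def
    by simp
qed

text \<open>The determinant of the \<gamma> matrix enters with exponent \<open>- \<nu> / 2\<close>,
  but the trace with factor -1/2. Pulling out \<nu> therefore scales the observations by
  \<open>1 / \<nu>\<close>, the origin of \<open>1 / (n * \<nu>)\<close> in the estimators.\<close>

lemma g2_gauss_dev:
  assumes "(s, t, r) \<in> wishart_support" "c1 > 0" "c2 > 0" "c3\<^sup>2 < c1 * c2" "\<nu> > 0"
  shows "g2 \<nu> s t r c1 c2 c3 =
    (s * t - r\<^sup>2) powr ((\<nu> - 3) / 2) / (2 powr \<nu> * sqrt pi * Gamma (\<nu> / 2) * Gamma ((\<nu> - 1) / 2)) *
    exp (- (1 / 2) * (\<nu> * gauss_dev c1 c2 c3 (s / \<nu>) (t / \<nu>) (r / \<nu>)))"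
proof -
  define d where "d = c1 * c2 - c3\<^sup>2"
  have d: "d > 0" using assms by (simp add: d_def)
  have 1: "- (c1 * c2 / (2 * d)) * (s / c1 + t / c2 - 2 * c3 * r / (c1 * c2))
     = - (1 / 2) * ((c1 * t + c2 * s - 2 * c3 * r) / d)"
    using assms(2,3) d by (simp add: field_simps)
  have "\<nu> * gauss_dev c1 c2 c3 (s / \<nu>) (t / \<nu>) (r / \<nu>) = \<nu> * ln d + (c1 * t + c2 * s - 2 * c3 * r) / d"
    using assms(5) d unfolding gauss_dev_def d_def[symmetric] by (simp add: field_simps)
  moreover have "d powr (- \<nu> / 2) = exp (- (1 / 2) * (\<nu> * ln d))" using d by (simp add: powr_def)
  ultimately show ?thesis
    using assms(1) unfolding g2_def d_def[symmetric] 1 by (simp add: distrib_left field_simps flip: exp_add)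
qed

lemma sum_gauss_dev:
  assumes "n \<ge> 1"
  shows "(\<Sum>i=1..n. gauss_dev a b c (A i) (B i) (C i)) =
    real n * gauss_dev a b c (sample_mean n A) (sample_mean n B) (sample_mean n C)"
proof -
  have m: "real n * sample_mean n f = (\<Sum>i=1..n. f i)" for f
    using assms by (simp add: sample_mean_def)
  have "(\<Sum>i=1..n. gauss_dev a b c (A i) (B i) (C i)) = real n * ln (a * b - c\<^sup>2) +
     (a * (\<Sum>i=1..n. B i) + b * (\<Sum>i=1..n. A i) - 2 * c * (\<Sum>i=1..n. C i)) / (a * b - c\<^sup>2)"
    by (simp add: gauss_dev_def sum.distrib sum_subtractf sum_divide_distrib[symmetric] sum_distrib_left[symmetric])
  then show ?thesis
    unfolding m[symmetric] gauss_dev_def by (simp add: algebra_simps add_divide_distrib diff_divide_distrib)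
qed

lemma sample_mean_divide: "sample_mean n (\<lambda>i. f i / k) = sample_mean n f / k"
  by (simp add: sample_mean_def sum_divide_distrib mult.commute)

text \<open>The parallel axis identity. Its bilinear form covers the covariance and, with
  \<open>y = x\<close>, the variances.\<close>

lemma sample_mean_shift:
  assumes "n \<ge> 1"
  shows "sample_mean n (\<lambda>i. (x i - m) * (y i - k)) =
    sample_mean n (\<lambda>i. (x i - sample_mean n x) * (y i - sample_mean n y))
      + (sample_mean n x - m) * (sample_mean n y - k)"
proof -
  have e: "(\<Sum>i=1..n. (x i - m) * (y i - k)) =
     (\<Sum>i=1..n. x i * y i) - k * (\<Sum>i=1..n. x i) - m * (\<Sum>i=1..n. y i) + real n * (m * k)" for m k
    by (simp add: algebra_simps sum.distrib sum_subtractf sum_distrib_left)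
  have S: "(\<Sum>i=1..n. f i) = real n * sample_mean n f" for f
    using assms by (simp add: sample_mean_def)
  define p q z where "p = sample_mean n x" and "q = sample_mean n y" and "z = sample_mean n (\<lambda>i. x i * y i)"
  have "real n * sample_mean n (\<lambda>i. (x i - m) * (y i - k)) = real n * (z - k * p - m * q + m * k)" for m k
    using e[of m k] unfolding S p_def q_def z_def by (simp add: algebra_simps)
  \<comment> \<open>Stated for all centres: it is used at the given centre and at the sample
    means.\<close>
  then have "sample_mean n (\<lambda>i. (x i - m) * (y i - k)) = z - k * p - m * q + m * k" for m k
    using assms by simp
  note this[unfolded p_def q_def]
  then show ?thesis by (simp only:) (simp add: algebra_simps)
qed

lemma tau_hat_sample_mean:
  "var_x (tau_hat \<nu> n x y s t r) = sample_mean n (\<lambda>i. (x i - sample_mean n x) * (x i - sample_mean n x))"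
  "var_y (tau_hat \<nu> n x y s t r) = sample_mean n (\<lambda>i. (y i - sample_mean n y) * (y i - sample_mean n y))"
  "sigma_xy_hat n x y = sample_mean n (\<lambda>i. (x i - sample_mean n x) * (y i - sample_mean n y))"
  "gamma1 (tau_hat \<nu> n x y s t r) = sample_mean n s / \<nu>"
  "gamma2 (tau_hat \<nu> n x y s t r) = sample_mean n t / \<nu>"
  "gamma3 (tau_hat \<nu> n x y s t r) = sample_mean n r / \<nu>"
  by (simp_all add: tau_hat_def sigma_xy_hat_def sample_mean_def power2_eq_square mult.commute)

text \<open>\<open>- 2 / n\<close> times the log-likelihood, up to an additive constant.\<close>

definition deviance :: "real \<Rightarrow> nat \<Rightarrow> (nat \<Rightarrow> real) \<Rightarrow> (nat \<Rightarrow> real) \<Rightarrow> (nat \<Rightarrow> real) \<Rightarrow> (nat \<Rightarrow> real) \<Rightarrow>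
    (nat \<Rightarrow> real) \<Rightarrow> params \<Rightarrow> real" where
  "deviance \<nu> n x y s t r \<tau> =
     gauss_dev (var_x \<tau>) (var_y \<tau>) (cov_param \<tau>)
       (var_x (tau_hat \<nu> n x y s t r) + (sample_mean n x - mu_x \<tau>)\<^sup>2)
       (var_y (tau_hat \<nu> n x y s t r) + (sample_mean n y - mu_y \<tau>)\<^sup>2)
       (sigma_xy_hat n x y + (sample_mean n x - mu_x \<tau>) * (sample_mean n y - mu_y \<tau>)) +
     \<nu> * gauss_dev (gamma1 \<tau>) (gamma2 \<tau>) (gamma3 \<tau>)
       (gamma1 (tau_hat \<nu> n x y s t r)) (gamma2 (tau_hat \<nu> n x y s t r)) (gamma3 (tau_hat \<nu> n x y s t r))"

text \<open>\<open>K\<close> collects the factors that depend on the sample but not on the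
  parameters, so maximising the likelihood amounts to minimising the deviance.\<close>

lemma likelihood_deviance:
  assumes "\<nu> > 2" and n: "n \<ge> 1"
    and supp: "\<And>i. i \<in> {1..n} \<Longrightarrow> (s i, t i, r i) \<in> wishart_support"
  obtains K where "K > 0"
    "\<And>\<tau>. \<tau> \<in> param_space \<Longrightarrow>
      likelihood \<nu> n x y s t r \<tau> = K * exp (- (real n / 2) * deviance \<nu> n x y s t r \<tau>)"
proof -
  define k where "k i = 1 / (2 * pi) * ((s i * t i - (r i)\<^sup>2) powr ((\<nu> - 3) / 2) /
    (2 powr \<nu> * sqrt pi * Gamma (\<nu> / 2) * Gamma ((\<nu> - 1) / 2)))" for i
  have k: "k i > 0" if "i \<in> {1..n}" for i
  proof -
    have st: "s i > 0" "t i > 0" "\<bar>r i\<bar> < sqrt (s i * t i)"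
      using supp[OF that] by (auto simp: wishart_support_def)
    then have "(r i)\<^sup>2 < s i * t i"
      by (metis abs_ge_zero power2_abs power_strict_mono real_sqrt_pow2 mult_pos_pos less_imp_le pos2)
    moreover have "Gamma (\<nu> / 2) > 0" "Gamma ((\<nu> - 1) / 2) > 0"
      using \<open>\<nu> > 2\<close> by (auto intro!: Gamma_real_pos)
    ultimately show ?thesis unfolding k_def by simp
  qed
  have "likelihood \<nu> n x y s t r \<tau> = prod k {1..n} * exp (- (real n / 2) * deviance \<nu> n x y s t r \<tau>)"
    if \<tau>: "\<tau> \<in> param_space" for \<tau>
  proof -
    define G H where "G i = gauss_dev (var_x \<tau>) (var_y \<tau>) (cov_param \<tau>)
        ((x i - mu_x \<tau>)\<^sup>2) ((y i - mu_y \<tau>)\<^sup>2) ((x i - mu_x \<tau>) * (y i - mu_y \<tau>))"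
      and "H i = gauss_dev (gamma1 \<tau>) (gamma2 \<tau>) (gamma3 \<tau>) (s i / \<nu>) (t i / \<nu>) (r i / \<nu>)" for i
    have "likelihood \<nu> n x y s t r \<tau> = (\<Prod>i=1..n. k i * exp (- (1 / 2) * (G i + \<nu> * H i)))"
      unfolding likelihood_def
    proof (rule prod.cong[OF refl])
      fix i assume i: "i \<in> {1..n}"
      have 1: "g1 (x i) (y i) (mu_x \<tau>) (mu_y \<tau>) (var_x \<tau>) (var_y \<tau>) (rho \<tau>) = 1 / (2 * pi) * exp (- (1 / 2) * G i)"
        unfolding G_def cov_param_def using \<tau> by (intro g1_gauss_dev) (auto simp: param_space_def)
      have 2: "g2 \<nu> (s i) (t i) (r i) (gamma1 \<tau>) (gamma2 \<tau>) (gamma3 \<tau>) =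
        (s i * t i - (r i)\<^sup>2) powr ((\<nu> - 3) / 2) / (2 powr \<nu> * sqrt pi * Gamma (\<nu> / 2) * Gamma ((\<nu> - 1) / 2)) *
        exp (- (1 / 2) * (\<nu> * H i))"
        unfolding H_def using \<tau> \<open>\<nu> > 2\<close> by (intro g2_gauss_dev supp i) (auto simp: param_space_def)
      show "g1 (x i) (y i) (mu_x \<tau>) (mu_y \<tau>) (var_x \<tau>) (var_y \<tau>) (rho \<tau>) *
          g2 \<nu> (s i) (t i) (r i) (gamma1 \<tau>) (gamma2 \<tau>) (gamma3 \<tau>) = k i * exp (- (1 / 2) * (G i + \<nu> * H i))"
        unfolding 1 2 k_def distrib_left exp_add by simp
    qed
    also have "\<dots> = prod k {1..n} * exp (\<Sum>i=1..n. - (1 / 2) * (G i + \<nu> * H i))"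
      by (simp only: prod.distrib exp_sum finite_atLeastAtMost)
    also have "(\<Sum>i=1..n. - (1 / 2) * (G i + \<nu> * H i)) = - (1 / 2) * (sum G {1..n} + \<nu> * sum H {1..n})"
      by (simp only: sum_distrib_left[symmetric] sum.distrib)
    \<comment> \<open>Averaging inside \<open>gauss_dev\<close>, then the parallel axis identity for
      the three second moments.\<close>
    also have "sum G {1..n} + \<nu> * sum H {1..n} = real n * deviance \<nu> n x y s t r \<tau>"
      unfolding G_def H_def sum_gauss_dev[OF n] sample_mean_divide power2_eq_square
        sample_mean_shift[OF n, of x "mu_x \<tau>" y "mu_y \<tau>"]
        sample_mean_shift[OF n, of x "mu_x \<tau>" x "mu_x \<tau>"]
        sample_mean_shift[OF n, of y "mu_y \<tau>" y "mu_y \<tau>"] deviance_def tau_hat_sample_mean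
      by (simp only: distrib_left mult.left_commute)
    finally show ?thesis by simp
  qed
  moreover have "prod k {1..n} > 0" using k by (rule prod_pos)
  ultimately show ?thesis using that by blast
qed

lemma is_mle_iff_deviance:
  assumes "\<nu> > 2" "n \<ge> 1"
    and "\<And>i. i \<in> {1..n} \<Longrightarrow> (s i, t i, r i) \<in> wishart_support"
  shows "is_mle \<nu> n x y s t r \<tau> \<longleftrightarrow> \<tau> \<in> param_space \<and>
    (\<forall>\<tau>'\<in>param_space. deviance \<nu> n x y s t r \<tau> \<le> deviance \<nu> n x y s t r \<tau>')"
proof -
  obtain K where K: "K > 0" "\<And>\<tau>. \<tau> \<in> param_space \<Longrightarrow>
      likelihood \<nu> n x y s t r \<tau> = K * exp (- (real n / 2) * deviance \<nu> n x y s t r \<tau>)"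
    using likelihood_deviance[of \<nu> n s t r x y, OF assms] by blast
  show ?thesis
    using K(1) assms(2) by (auto simp: is_mle_def is_arg_max_def K(2) not_less)
qed

section \<open>The estimators: admissibility, optimality and degenerate samples\<close>

text \<open>The triangle inequality, the support condition
  \<open>\<bar>r i\<bar> < sqrt (s i) * sqrt (t i)\<close> and Cauchy-Schwarz. Each observed matrix
  is positive definite, so strictness holds already for a single observation.\<close>

lemma gamma_hat_pos:
  fixes x y :: "nat \<Rightarrow> real"
  assumes "\<nu> > 2" and n: "n \<ge> 1"
    and supp: "\<And>i. i \<in> {1..n} \<Longrightarrow> (s i, t i, r i) \<in> wishart_support"
  defines "T \<equiv> tau_hat \<nu> n x y s t r"
  shows "gamma1 T > 0" "gamma2 T > 0" "(gamma3 T)\<^sup>2 < gamma1 T * gamma2 T"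
proof -
  have st: "s i > 0" "t i > 0" "\<bar>r i\<bar> < sqrt (s i) * sqrt (t i)" if "i \<in> {1..n}" for i
    using supp[OF that] by (auto simp: wishart_support_def real_sqrt_mult)
  have c: "0 < 1 / (real n * \<nu>)" using assms by simp
  have ne: "{1..n} \<noteq> {}" using n by auto
  have S: "(\<Sum>i=1..n. s i) > 0" "(\<Sum>i=1..n. t i) > 0"
    using st ne by (auto intro!: sum_pos)
  show "gamma1 T > 0" "gamma2 T > 0"
    using c S by (auto simp: T_def tau_hat_def)
  have "\<bar>\<Sum>i=1..n. r i\<bar> \<le> (\<Sum>i=1..n. \<bar>r i\<bar>)" by (rule sum_abs)
  also have "\<dots> < (\<Sum>i=1..n. sqrt (s i) * sqrt (t i))"
    using st ne by (intro sum_strict_mono) auto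
  finally have "\<bar>\<Sum>i=1..n. r i\<bar>\<^sup>2 < (\<Sum>i=1..n. sqrt (s i) * sqrt (t i))\<^sup>2"
    by (intro power_strict_mono) auto
  also have "\<dots> \<le> (\<Sum>i=1..n. (sqrt (s i))\<^sup>2) * (\<Sum>i=1..n. (sqrt (t i))\<^sup>2)"
    by (rule Cauchy_Schwarz_ineq_sum)
  also have "\<dots> = (\<Sum>i=1..n. s i) * (\<Sum>i=1..n. t i)"
    using st by (intro arg_cong2[where f="(*)"] sum.cong) (auto intro: less_imp_le)
  finally have "(1 / (real n * \<nu>))\<^sup>2 * (\<Sum>i=1..n. r i)\<^sup>2 <
      (1 / (real n * \<nu>))\<^sup>2 * ((\<Sum>i=1..n. s i) * (\<Sum>i=1..n. t i))"
    using c unfolding power2_abs by (intro mult_strict_left_mono zero_less_power)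
  then have "(1 / (real n * \<nu>) * (\<Sum>i=1..n. r i))\<^sup>2 <
      1 / (real n * \<nu>) * (\<Sum>i=1..n. s i) * (1 / (real n * \<nu>) * (\<Sum>i=1..n. t i))"
    by (simp only: power2_eq_square mult_ac)
  then show "(gamma3 T)\<^sup>2 < gamma1 T * gamma2 T"
    by (simp only: T_def tau_hat_def params.simps)
qed

lemma tau_hat_var_nonneg:
  "0 \<le> var_x (tau_hat \<nu> n x y s t r)" "0 \<le> var_y (tau_hat \<nu> n x y s t r)"
  by (auto simp: tau_hat_def intro!: divide_nonneg_nonneg sum_nonneg)

text \<open>Cauchy-Schwarz for the centred samples. Equality is the singular case, in which no
  maximiser exists.\<close>

lemma sigma_xy_hat_le:
  "(sigma_xy_hat n x y)\<^sup>2 \<le> var_x (tau_hat \<nu> n x y s t r) * var_y (tau_hat \<nu> n x y s t r)"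
proof -
  have "(1 / real n)\<^sup>2 * (\<Sum>i=1..n. (y i - sample_mean n y) * (x i - sample_mean n x))\<^sup>2 \<le>
     (1 / real n)\<^sup>2 * ((\<Sum>i=1..n. (y i - sample_mean n y)\<^sup>2) * (\<Sum>i=1..n. (x i - sample_mean n x)\<^sup>2))"
    by (intro mult_left_mono Cauchy_Schwarz_ineq_sum) auto
  then show ?thesis
    by (simp add: sigma_xy_hat_def tau_hat_def power_mult_distrib power2_eq_square mult_ac)
qed

text \<open>The factors \<open>1 / n\<close> cancel. If a variance estimate vanishes, both sides are
  quotients by zero, hence 0.\<close>

lemma rho_tau_hat:
  assumes "n \<ge> 1"
  shows "rho (tau_hat \<nu> n x y s t r) = sigma_xy_hat n x y /
    (sqrt (var_x (tau_hat \<nu> n x y s t r)) * sqrt (var_y (tau_hat \<nu> n x y s t r)))"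
proof -
  define X Y Z where "X = (\<Sum>i=1..n. (x i - sample_mean n x)\<^sup>2)"
    and "Y = (\<Sum>i=1..n. (y i - sample_mean n y)\<^sup>2)"
    and "Z = (\<Sum>i=1..n. (y i - sample_mean n y) * (x i - sample_mean n x))"
  have "sqrt (1 / real n * X) * sqrt (1 / real n * Y) = 1 / real n * sqrt (Y * X)"
    by (simp add: real_sqrt_mult real_sqrt_divide)
  then show ?thesis
    using assms unfolding tau_hat_def sigma_xy_hat_def X_def[symmetric] Y_def[symmetric] Z_def[symmetric]
    by simp
qed

lemma cov_param_tau_hat:
  assumes "n \<ge> 1" "(sigma_xy_hat n x y)\<^sup>2 < var_x (tau_hat \<nu> n x y s t r) * var_y (tau_hat \<nu> n x y s t r)"
  shows "cov_param (tau_hat \<nu> n x y s t r) = sigma_xy_hat n x y"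
proof -
  have "var_x (tau_hat \<nu> n x y s t r) \<noteq> 0" "var_y (tau_hat \<nu> n x y s t r) \<noteq> 0"
    using assms(2) by auto
  then show ?thesis unfolding cov_param_def rho_tau_hat[OF assms(1)] by simp
qed

lemma abs_corr_less_1:
  assumes "a > 0" "b > 0" "c\<^sup>2 < a * (b::real)"
  shows "\<bar>c / (sqrt a * sqrt b)\<bar> < 1"
proof -
  have "\<bar>c\<bar> < sqrt (a * b)" using assms by (metis real_less_rsqrt power2_abs)
  then show ?thesis using assms by (simp add: real_sqrt_mult abs_mult)
qed

lemma tau_hat_in_param_space:
  assumes "\<nu> > 2" "n \<ge> 1"
    and "\<And>i. i \<in> {1..n} \<Longrightarrow> (s i, t i, r i) \<in> wishart_support"
    and "(sigma_xy_hat n x y)\<^sup>2 < var_x (tau_hat \<nu> n x y s t r) * var_y (tau_hat \<nu> n x y s t r)"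
  shows "tau_hat \<nu> n x y s t r \<in> param_space"
proof -
  let ?T = "tau_hat \<nu> n x y s t r"
  have "var_x ?T * var_y ?T > 0" using assms(4) zero_le_power2 order.strict_trans1 by blast
  then have v: "var_x ?T > 0" "var_y ?T > 0"
    using tau_hat_var_nonneg[of \<nu> n x y s t r] by (auto simp: zero_less_mult_iff)
  then have "\<bar>rho ?T\<bar> < 1"
    unfolding rho_tau_hat[OF assms(2)] using assms(4) by (intro abs_corr_less_1)
  then show ?thesis
    using v gamma_hat_pos[OF assms(1-3), where x = x and y = y] by (simp add: param_space_def)
qed

text \<open>The deviance is bounded below in three places: the mean shift, the covariance matrix and
  the \<gamma> matrix. All three bounds are attained at \<open>tau_hat\<close>, so equality of the
  total leaves no slack in any of them and determines every parameter.\<close>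

lemma deviance_tau_hat:
  assumes "\<nu> > 2" "n \<ge> 1"
    and "\<And>i. i \<in> {1..n} \<Longrightarrow> (s i, t i, r i) \<in> wishart_support"
    and lt: "(sigma_xy_hat n x y)\<^sup>2 < var_x (tau_hat \<nu> n x y s t r) * var_y (tau_hat \<nu> n x y s t r)"
    and \<tau>: "\<tau> \<in> param_space"
  shows "deviance \<nu> n x y s t r (tau_hat \<nu> n x y s t r) \<le> deviance \<nu> n x y s t r \<tau>"
    and "deviance \<nu> n x y s t r \<tau> \<le> deviance \<nu> n x y s t r (tau_hat \<nu> n x y s t r) \<Longrightarrow>
      \<tau> = tau_hat \<nu> n x y s t r"
proof -
  let ?T = "tau_hat \<nu> n x y s t r"
  let ?p = "sample_mean n x - mu_x \<tau>" and ?q = "sample_mean n y - mu_y \<tau>"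
  let ?C = "sigma_xy_hat n x y"
  have T: "?T \<in> param_space" by (rule tau_hat_in_param_space[OF assms(1-4)])
  have mT: "mu_x ?T = sample_mean n x" "mu_y ?T = sample_mean n y" by (auto simp: tau_hat_def)
  have cT: "cov_param ?T = ?C" by (rule cov_param_tau_hat[OF assms(2) lt])
  have vT: "var_x ?T > 0" "var_y ?T > 0" and gT: "gamma1 ?T > 0" "gamma2 ?T > 0" "(gamma3 ?T)\<^sup>2 < gamma1 ?T * gamma2 ?T"
    using T by (auto simp: param_space_def)
  have v: "var_x \<tau> > 0" "var_y \<tau> > 0" and g: "gamma1 \<tau> > 0" "gamma2 \<tau> > 0" "(gamma3 \<tau>)\<^sup>2 < gamma1 \<tau> * gamma2 \<tau>"
    using \<tau> by (auto simp: param_space_def)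
  note c = cov_param_less[OF \<tau>]
  note sh = gauss_dev_shift[OF v(1) c, where A = "var_x ?T" and B = "var_y ?T" and C = ?C and p = ?p and q = ?q]
  note G = gauss_dev_ge[OF v c vT lt]
  note W = gauss_dev_ge[OF g gT]
  have W': "\<nu> * gauss_dev (gamma1 ?T) (gamma2 ?T) (gamma3 ?T) (gamma1 ?T) (gamma2 ?T) (gamma3 ?T)
      \<le> \<nu> * gauss_dev (gamma1 \<tau>) (gamma2 \<tau>) (gamma3 \<tau>) (gamma1 ?T) (gamma2 ?T) (gamma3 ?T)"
    using W(1) assms(1) by simp
  have dT: "deviance \<nu> n x y s t r ?T = gauss_dev (var_x ?T) (var_y ?T) ?C (var_x ?T) (var_y ?T) ?C
     + \<nu> * gauss_dev (gamma1 ?T) (gamma2 ?T) (gamma3 ?T) (gamma1 ?T) (gamma2 ?T) (gamma3 ?T)"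
    by (simp add: deviance_def mT cT)
  show "deviance \<nu> n x y s t r ?T \<le> deviance \<nu> n x y s t r \<tau>"
    unfolding dT using sh(1) G(1) W' unfolding deviance_def by linarith
  assume le: "deviance \<nu> n x y s t r \<tau> \<le> deviance \<nu> n x y s t r ?T"
  note le' = le[unfolded dT, unfolded deviance_def]
  have "?p = 0 \<and> ?q = 0" by (rule sh(2)) (use le' sh(1) G(1) W' in linarith)
  moreover have "var_x \<tau> = var_x ?T \<and> var_y \<tau> = var_y ?T \<and> cov_param \<tau> = ?C"
    by (rule G(2)) (use le' sh(1) G(1) W' in linarith)
  moreover have "\<nu> * gauss_dev (gamma1 \<tau>) (gamma2 \<tau>) (gamma3 \<tau>) (gamma1 ?T) (gamma2 ?T) (gamma3 ?T)
      \<le> \<nu> * gauss_dev (gamma1 ?T) (gamma2 ?T) (gamma3 ?T) (gamma1 ?T) (gamma2 ?T) (gamma3 ?T)"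
    using le' sh(1) G(1) by linarith
  then have "gamma1 \<tau> = gamma1 ?T \<and> gamma2 \<tau> = gamma2 ?T \<and> gamma3 \<tau> = gamma3 ?T"
    using assms(1) by (intro W(2)) simp
  \<comment> \<open>The correlation is recovered from the off-diagonal entry because the variances
    agree and are positive.\<close>
  moreover have "rho \<tau> = rho ?T"
  proof -
    have "cov_param \<tau> = cov_param ?T" using calculation cT by simp
    then show ?thesis using calculation vT by (simp add: cov_param_def)
  qed
  ultimately show "\<tau> = ?T" using mT by (intro params.equality) auto
qed

text \<open>If the sample covariance matrix were singular, changing only the normal parameters would
  push the deviance below that of the supposed maximiser.\<close>

lemma mle_imp_nondegenerate:
  assumes "\<nu> > 2" "n \<ge> 1"
    and "\<And>i. i \<in> {1..n} \<Longrightarrow> (s i, t i, r i) \<in> wishart_support"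
    and mle: "is_mle \<nu> n x y s t r \<tau>"
  shows "(sigma_xy_hat n x y)\<^sup>2 < var_x (tau_hat \<nu> n x y s t r) * var_y (tau_hat \<nu> n x y s t r)"
proof (rule ccontr)
  let ?T = "tau_hat \<nu> n x y s t r" and ?C = "sigma_xy_hat n x y"
  assume "\<not> ?C\<^sup>2 < var_x ?T * var_y ?T"
  then have "var_x ?T * var_y ?T = ?C\<^sup>2"
    using sigma_xy_hat_le[of n x y \<nu> s t r] by simp
  \<comment> \<open>The bound is what remains of the deviance of \<tau> after its \<gamma> term,
    which is kept unchanged.\<close>
  then obtain a b c where abc: "a > 0" "b > 0" "c\<^sup>2 < a * b"
    "gauss_dev a b c (var_x ?T) (var_y ?T) ?C < deviance \<nu> n x y s t r \<tau> -
      \<nu> * gauss_dev (gamma1 \<tau>) (gamma2 \<tau>) (gamma3 \<tau>) (gamma1 ?T) (gamma2 ?T) (gamma3 ?T)"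
    using gauss_dev_unbounded_below tau_hat_var_nonneg by metis
  have min: "\<tau> \<in> param_space" "\<And>\<tau>'. \<tau>' \<in> param_space \<Longrightarrow>
      deviance \<nu> n x y s t r \<tau> \<le> deviance \<nu> n x y s t r \<tau>'"
    using mle is_mle_iff_deviance[OF assms(1-3)] by auto
  \<comment> \<open>The sample means make the shift vanish, and this \<open>rho\<close> gives the
    off-diagonal entry \<open>c\<close>.\<close>
  define \<sigma> where "\<sigma> = \<tau>\<lparr> mu_x := sample_mean n x, mu_y := sample_mean n y,
    var_x := a, var_y := b, rho := c / (sqrt a * sqrt b) \<rparr>"
  have "\<sigma> \<in> param_space"
    using min(1) abc abs_corr_less_1[OF abc(1-3)] by (simp add: param_space_def \<sigma>_def)
  moreover have "cov_param \<sigma> = c" using abc by (simp add: cov_param_def \<sigma>_def)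
  then have "deviance \<nu> n x y s t r \<sigma> < deviance \<nu> n x y s t r \<tau>"
    using abc(4) by (simp add: deviance_def \<sigma>_def)
  ultimately show False using min(2) by fastforce
qed

text \<open>The equality case of Cauchy-Schwarz: a singular sample covariance matrix puts all points
  on the regression line.\<close>

lemma noncollinear_imp_nondegenerate:
  assumes n: "n \<ge> 1" and nc: "\<not> collinear ((\<lambda>i. (x i, y i)) ` {1..n})"
  shows "(sigma_xy_hat n x y)\<^sup>2 < var_x (tau_hat \<nu> n x y s t r) * var_y (tau_hat \<nu> n x y s t r)"
proof (rule ccontr)
  define X Y where "X i = x i - sample_mean n x" and "Y i = y i - sample_mean n y" for i
  define A B C where "A = (\<Sum>i=1..n. (X i)\<^sup>2)" and "B = (\<Sum>i=1..n. (Y i)\<^sup>2)" and "C = (\<Sum>i=1..n. Y i * X i)"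
  assume "\<not> ?thesis"
  then have "(1 / real n)\<^sup>2 * C\<^sup>2 = (1 / real n)\<^sup>2 * (A * B)"
    using sigma_xy_hat_le[of n x y \<nu> s t r]
    by (simp add: sigma_xy_hat_def tau_hat_def A_def B_def C_def X_def Y_def power2_eq_square mult_ac)
  then have AB: "A * B = C\<^sup>2" using n by simp
  \<comment> \<open>Collinearity is defined by differences of points, in which the sample means
    cancel.\<close>
  have diff: "(x i, y i) - (x j, y j) = (X i - X j, Y i - Y j)" for i j by (simp add: X_def Y_def)
  have "\<exists>u. \<forall>i\<in>{1..n}. \<forall>j\<in>{1..n}. \<exists>k. (x i, y i) - (x j, y j) = k *\<^sub>R u"
  proof (cases "A = 0")
    \<comment> \<open>All \<open>x i\<close> coincide, so the line is vertical.\<close>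
    case True
    then have "\<forall>i\<in>{1..n}. X i = 0" by (simp add: A_def sum_nonneg_eq_0_iff)
    then show ?thesis unfolding diff by (intro exI[of _ "(0, 1)"]) auto
  next
    case False
    \<comment> \<open>The residuals of the line of slope \<open>C / A\<close> have square sum zero.
      The expansion uses free \<open>a\<close> and \<open>c\<close> so that unfolding
      \<open>A\<close> and \<open>C\<close> leaves the coefficients alone.\<close>
    have "(a * Y i - c * X i)\<^sup>2 = a\<^sup>2 * (Y i)\<^sup>2 - 2 * a * c * (Y i * X i) + c\<^sup>2 * (X i)\<^sup>2" for a c i
      by (simp add: power2_eq_square algebra_simps)
    then have "(\<Sum>i=1..n. (a * Y i - c * X i)\<^sup>2) = a\<^sup>2 * B - 2 * a * c * C + c\<^sup>2 * A" for a c
      by (simp only: A_def B_def C_def sum.distrib sum_subtractf sum_distrib_left)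
    then have "(\<Sum>i=1..n. (A * Y i - C * X i)\<^sup>2) = A\<^sup>2 * B - 2 * A * C * C + C\<^sup>2 * A" .
    also have "\<dots> = A * (A * B - C\<^sup>2)" by (simp add: power2_eq_square algebra_simps)
    finally have "(\<Sum>i=1..n. (A * Y i - C * X i)\<^sup>2) = 0" using AB by simp
    then have "\<forall>i\<in>{1..n}. A * Y i = C * X i" by (simp add: sum_nonneg_eq_0_iff)
    then have Y: "\<forall>i\<in>{1..n}. Y i = C / A * X i" using False by (simp add: field_simps)
    show ?thesis unfolding diff
    proof (intro exI[of _ "(1, C / A)"] ballI)
      fix i j assume ij: "i \<in> {1..n}" "j \<in> {1..n}"
      show "\<exists>k. (X i - X j, Y i - Y j) = k *\<^sub>R (1, C / A)"
        using bspec[OF Y ij(1)] bspec[OF Y ij(2)]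
        by (intro exI[of _ "X i - X j"]) (simp add: diff_divide_distrib algebra_simps)
    qed
  qed
  then show False using nc unfolding collinear_def by (auto simp: ball_simps)
qed


section \<open>The covariance of the bivariate normal law\<close>

lemma has_bochner_integral_normal_quadratic:
  assumes "\<sigma> > 0"
  shows "has_bochner_integral lborel (\<lambda>x. normal_density \<mu> \<sigma> x * (p + q * (x - \<mu>) + r * (x - \<mu>)\<^sup>2))
    (p + r * \<sigma>\<^sup>2)"
proof -
  have 0: "has_bochner_integral lborel (normal_density \<mu> \<sigma>) 1"
    using normal_moment_even[OF assms, of \<mu> 0] by simp
  have 1: "has_bochner_integral lborel (\<lambda>x. normal_density \<mu> \<sigma> x * (x - \<mu>)) 0"
    using normal_moment_odd[OF assms, of \<mu> 0] by simp
  have 2: "has_bochner_integral lborel (\<lambda>x. normal_density \<mu> \<sigma> x * (x - \<mu>)\<^sup>2) (\<sigma>\<^sup>2)"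
    using normal_moment_even[OF assms, of \<mu> 1] by (simp add: fact_numeral)
  have "has_bochner_integral lborel (\<lambda>x. normal_density \<mu> \<sigma> x * p + normal_density \<mu> \<sigma> x * (x - \<mu>) * q
      + normal_density \<mu> \<sigma> x * (x - \<mu>)\<^sup>2 * r) (1 * p + 0 * q + \<sigma>\<^sup>2 * r)"
    by (intro has_bochner_integral_add has_bochner_integral_mult_left 0 1 2)
  then show ?thesis by (simp add: algebra_simps)
qed

lemmas integrable_normal_quadratic = integrable.intros[OF has_bochner_integral_normal_quadratic]
lemmas integral_normal_quadratic =
  has_bochner_integral_integral_eq[OF has_bochner_integral_normal_quadratic]

text \<open>Completing the square in \<open>y\<close>: the marginal density of \<open>x\<close>
  times the conditional density of \<open>y\<close>, whose mean is the regression line and whose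
  variance is \<open>vy * (1 - \<rho>\<^sup>2)\<close>.\<close>

lemma g1_factorization:
  assumes "vx > 0" "vy > 0" "\<bar>\<rho>\<bar> < 1"
  shows "g1 x y mx my vx vy \<rho> = normal_density mx (sqrt vx) x *
    normal_density (my + \<rho> * sqrt vy / sqrt vx * (x - mx)) (sqrt vy * sqrt (1 - \<rho>\<^sup>2)) y"
proof -
  define w where "w = sqrt (1 - \<rho>\<^sup>2)"
  have r: "1 - \<rho>\<^sup>2 > 0" using assms by (simp add: abs_square_less_1)
  have w: "w > 0" "1 - \<rho>\<^sup>2 = w\<^sup>2" using r by (auto simp: w_def)
  obtain p q where pq: "p > 0" "q > 0" "vx = p\<^sup>2" "vy = q\<^sup>2"
    using assms by (metis real_sqrt_gt_zero real_sqrt_pow2 less_imp_le)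
  have rho: "\<rho>\<^sup>2 = 1 - w\<^sup>2" using w by simp
  define X Y where "X = x - mx" and "Y = y - my"
  have Ye: "y - (my + \<rho> * q / p * X) = Y - \<rho> * q / p * X" by (simp add: Y_def)
  have c: "1 / (2 * pi * p * q * w) = 1 / sqrt (2 * pi * p\<^sup>2) * (1 / sqrt (2 * pi * (q * w)\<^sup>2))"
    using pq w by (simp add: real_sqrt_mult power_mult_distrib field_simps)
  \<comment> \<open>The coefficient 1 of \<open>X\<^sup>2\<close> is split as
    \<open>\<rho>\<^sup>2 + w\<^sup>2\<close>: the first part completes the square in
    \<open>Y\<close>, the second gives the marginal.\<close>
  have "- (1 / (2 * w\<^sup>2)) * (X\<^sup>2 / p\<^sup>2 - 2 * \<rho> * X * Y / (p * q) + Y\<^sup>2 / q\<^sup>2)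
      = - (X\<^sup>2 * \<rho>\<^sup>2 + X\<^sup>2 * w\<^sup>2) / (2 * w\<^sup>2 * p\<^sup>2) + \<rho> * X * Y / (w\<^sup>2 * p * q) - Y\<^sup>2 / (2 * w\<^sup>2 * q\<^sup>2)"
    using pq w unfolding rho by (simp add: field_simps power2_eq_square)
  also have "\<dots> = - X\<^sup>2 / (2 * p\<^sup>2) + - (Y - \<rho> * q / p * X)\<^sup>2 / (2 * (q * w)\<^sup>2)"
    using pq w by (simp add: field_simps power2_eq_square)
  finally have e: "- (1 / (2 * w\<^sup>2)) * (X\<^sup>2 / p\<^sup>2 - 2 * \<rho> * X * Y / (p * q) + Y\<^sup>2 / q\<^sup>2)
      = - X\<^sup>2 / (2 * p\<^sup>2) + - (Y - \<rho> * q / p * X)\<^sup>2 / (2 * (q * w)\<^sup>2)" .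
  have s: "sqrt vx = p" "sqrt vy = q" using pq by auto
  show ?thesis
    unfolding g1_def normal_density_def w_def[symmetric] s
    unfolding w(2) pq(3,4) X_def[symmetric] Ye Y_def[symmetric] c e exp_add by simp
qed

lemma g1_measurable [measurable]:
  "(\<lambda>(x, y). g1 x y mx my vx vy \<rho>) \<in> borel_measurable (lborel \<Otimes>\<^sub>M lborel)"
  unfolding g1_def by measurable

text \<open>Fubini over the conditional normal law of \<open>y\<close> given \<open>x\<close>; integrability on the plane comes from
  the dominating function \<open>W\<close>, whose integral is computed from nonnegative iterated moments.\<close>

lemma has_bochner_integral_g1:
  assumes v: "vx > 0" "vy > 0" "\<bar>\<rho>\<bar> < 1"
  shows "has_bochner_integral lborel (\<lambda>(x, y). g1 x y mx my vx vy \<rho> *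
      (p + q * (x - mx) + r * (y - my) + k * ((x - mx) * (y - my)))) (p + k * (\<rho> * sqrt vx * sqrt vy))"
proof -
  let ?L = "lborel :: real measure"
  define N where "N = normal_density mx (sqrt vx)"
  define \<beta> where "\<beta> = \<rho> * sqrt vy / sqrt vx"
  define \<omega> where "\<omega> = sqrt vy * sqrt (1 - \<rho>\<^sup>2)"
  define f where "f x y = g1 x y mx my vx vy \<rho>" for x y
  have \<omega>: "\<omega> > 0" using v by (simp add: \<omega>_def abs_square_less_1)
  have sx: "sqrt vx > 0" using v by simp
  have f: "f x y = N x * normal_density (my + \<beta> * (x - mx)) \<omega> y" for x y
    unfolding f_def N_def \<beta>_def \<omega>_def by (rule g1_factorization[OF v])
  have fn: "f x y \<ge> 0" for x y unfolding f N_def by simp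
  have fm [measurable]: "(\<lambda>z. f (fst z) (snd z)) \<in> borel_measurable (?L \<Otimes>\<^sub>M ?L)"
    unfolding f_def using g1_measurable by (simp add: case_prod_beta)
  \<comment> \<open>Rewritten around the conditional mean \<open>\<mu>\<close>, the quadratic in
    \<open>y\<close> loses its linear term on integration.\<close>
  have inner: "has_bochner_integral ?L
      (\<lambda>y. f x y * (a + b * (y - my) + c * (y - my)\<^sup>2))
      (N x * (a + b * \<beta> * (x - mx) + c * (\<beta>\<^sup>2 * (x - mx)\<^sup>2 + \<omega>\<^sup>2)))" for x a b c
  proof -
    define \<mu> where "\<mu> = my + \<beta> * (x - mx)"
    have "has_bochner_integral ?L (\<lambda>y. N x * (normal_density \<mu> \<omega> y *
      ((a + b * \<beta> * (x - mx) + c * \<beta>\<^sup>2 * (x - mx)\<^sup>2) + (b + 2 * c * \<beta> * (x - mx)) * (y - \<mu>) + c * (y - \<mu>)\<^sup>2)))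
      (N x * ((a + b * \<beta> * (x - mx) + c * \<beta>\<^sup>2 * (x - mx)\<^sup>2) + c * \<omega>\<^sup>2))"
      by (intro has_bochner_integral_mult_right has_bochner_integral_normal_quadratic \<omega>)
    moreover have "N x * (normal_density \<mu> \<omega> y *
      ((a + b * \<beta> * (x - mx) + c * \<beta>\<^sup>2 * (x - mx)\<^sup>2) + (b + 2 * c * \<beta> * (x - mx)) * (y - \<mu>) + c * (y - \<mu>)\<^sup>2))
      = f x y * (a + b * (y - my) + c * (y - my)\<^sup>2)" for y
      unfolding f \<mu>_def by (simp add: power2_eq_square algebra_simps)
    moreover have "N x * ((a + b * \<beta> * (x - mx) + c * \<beta>\<^sup>2 * (x - mx)\<^sup>2) + c * \<omega>\<^sup>2) =
      N x * (a + b * \<beta> * (x - mx) + c * (\<beta>\<^sup>2 * (x - mx)\<^sup>2 + \<omega>\<^sup>2))"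
      by (simp add: algebra_simps)
    ultimately show ?thesis by simp
  qed
  define W where "W = (\<lambda>z. f (fst z) (snd z) * (1 + (fst z - mx)\<^sup>2 + (snd z - my)\<^sup>2))"
  have Wn: "0 \<le> W z" for z unfolding W_def using fn by simp
  have W: "integrable (?L \<Otimes>\<^sub>M ?L) W"
  proof (rule lborel_pair.Fubini_integrable)
    show "W \<in> borel_measurable (?L \<Otimes>\<^sub>M ?L)" unfolding W_def by measurable
    have i: "has_bochner_integral ?L (\<lambda>y. W (x, y)) (N x * (1 + (x - mx)\<^sup>2 + (\<beta>\<^sup>2 * (x - mx)\<^sup>2 + \<omega>\<^sup>2)))" for x
      using inner[of x "1 + (x - mx)\<^sup>2" 0 1] by (simp add: W_def)
    \<comment> \<open>\<open>W\<close> is nonnegative, so the norm drops out and a quadratic against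
      \<open>N\<close> remains.\<close>
    have "(\<integral>y. norm (W (x, y)) \<partial>?L) = N x * ((1 + \<omega>\<^sup>2) + 0 * (x - mx) + (1 + \<beta>\<^sup>2) * (x - mx)\<^sup>2)" for x
      using has_bochner_integral_integral_eq[OF i[of x]] Wn by (simp add: algebra_simps)
    then show "integrable ?L (\<lambda>x. \<integral>y. norm (W (x, y)) \<partial>?L)"
      using integrable_normal_quadratic[OF sx] unfolding N_def by presburger
    show "AE x in ?L. integrable ?L (\<lambda>y. W (x, y))"
      using i by (auto intro: integrable.intros)
  qed
  define h where "h = (\<lambda>z. p + q * (fst z - mx) + r * (snd z - my) + k * ((fst z - mx) * (snd z - my)))"
  \<comment> \<open>Each of 1, |X|, |Y| and |XY| is at most 1 + X^2 + Y^2, so \<open>W\<close>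
    dominates up to a constant factor.\<close>
  have hb: "\<bar>h z\<bar> \<le> (\<bar>p\<bar> + \<bar>q\<bar> + \<bar>r\<bar> + \<bar>k\<bar>) * (1 + (fst z - mx)\<^sup>2 + (snd z - my)\<^sup>2)" for z
  proof -
    define X Y S where "X = fst z - mx" and "Y = snd z - my" and "S = 1 + X\<^sup>2 + Y\<^sup>2"
    have u: "\<bar>u\<bar> \<le> 1 + u\<^sup>2" for u :: real
      using zero_le_power2[of "\<bar>u\<bar> - 1"] by (simp add: power2_diff)
    have S: "1 \<le> S" "\<bar>X\<bar> \<le> S" "\<bar>Y\<bar> \<le> S"
      using u[of X] u[of Y] zero_le_power2[of X] zero_le_power2[of Y] unfolding S_def by linarith+
    have "2 * (\<bar>X\<bar> * \<bar>Y\<bar>) \<le> X\<^sup>2 + Y\<^sup>2"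
      using zero_le_power2[of "\<bar>X\<bar> - \<bar>Y\<bar>"] by (simp add: power2_diff)
    moreover have "0 \<le> \<bar>X\<bar> * \<bar>Y\<bar>" by simp
    ultimately have XY: "\<bar>X * Y\<bar> \<le> S" unfolding abs_mult S_def by linarith
    have "\<bar>h z\<bar> \<le> \<bar>p\<bar> * 1 + \<bar>q\<bar> * \<bar>X\<bar> + \<bar>r\<bar> * \<bar>Y\<bar> + \<bar>k\<bar> * \<bar>X * Y\<bar>"
      unfolding h_def X_def[symmetric] Y_def[symmetric] abs_mult[symmetric] by linarith
    also have "\<dots> \<le> \<bar>p\<bar> * S + \<bar>q\<bar> * S + \<bar>r\<bar> * S + \<bar>k\<bar> * S"
      by (intro add_mono mult_left_mono S XY) auto
    finally show ?thesis by (simp add: S_def X_def Y_def algebra_simps)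
  qed
  have int: "integrable (?L \<Otimes>\<^sub>M ?L) (\<lambda>z. f (fst z) (snd z) * h z)"
  proof (rule Bochner_Integration.integrable_bound)
    show "integrable (?L \<Otimes>\<^sub>M ?L) (\<lambda>z. (\<bar>p\<bar> + \<bar>q\<bar> + \<bar>r\<bar> + \<bar>k\<bar>) * W z)" using W by simp
    show "(\<lambda>z. f (fst z) (snd z) * h z) \<in> borel_measurable (?L \<Otimes>\<^sub>M ?L)" unfolding h_def by measurable
    have "norm (f (fst z) (snd z) * h z) \<le> norm ((\<bar>p\<bar> + \<bar>q\<bar> + \<bar>r\<bar> + \<bar>k\<bar>) * W z)" for z
    proof -
      have "norm (f (fst z) (snd z) * h z) = f (fst z) (snd z) * \<bar>h z\<bar>" using fn by (simp add: abs_mult)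
      also have "\<dots> \<le> f (fst z) (snd z) * ((\<bar>p\<bar> + \<bar>q\<bar> + \<bar>r\<bar> + \<bar>k\<bar>) * (1 + (fst z - mx)\<^sup>2 + (snd z - my)\<^sup>2))"
        by (intro mult_left_mono hb fn)
      also have "\<dots> = (\<bar>p\<bar> + \<bar>q\<bar> + \<bar>r\<bar> + \<bar>k\<bar>) * W z" by (simp add: W_def)
      finally show ?thesis using Wn by simp
    qed
    then show "AE z in ?L \<Otimes>\<^sub>M ?L. norm (f (fst z) (snd z) * h z) \<le> norm ((\<bar>p\<bar> + \<bar>q\<bar> + \<bar>r\<bar> + \<bar>k\<bar>) * W z)" by simp
  qed
  \<comment> \<open>After integrating out \<open>y\<close>, the linear term in \<open>x - mx\<close>
    vanishes and the quadratic one contributes \<open>k * \<beta> * vx\<close>.\<close>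
  have "(\<integral>z. f (fst z) (snd z) * h z \<partial>(?L \<Otimes>\<^sub>M ?L)) = (\<integral>x. \<integral>y. f x y * h (x, y) \<partial>?L \<partial>?L)"
    using lborel_pair.integral_fst'[OF int] by simp
  also have "(\<lambda>x. \<integral>y. f x y * h (x, y) \<partial>?L) =
      (\<lambda>x. N x * (p + (q + r * \<beta>) * (x - mx) + k * \<beta> * (x - mx)\<^sup>2))"
  proof
    fix x
    show "(\<integral>y. f x y * h (x, y) \<partial>?L) = N x * (p + (q + r * \<beta>) * (x - mx) + k * \<beta> * (x - mx)\<^sup>2)"
      using has_bochner_integral_integral_eq[OF inner[of x "p + q * (x - mx)" "r + k * (x - mx)" 0]]
      by (simp add: h_def power2_eq_square algebra_simps)
  qed
  also have "(\<integral>x. N x * (p + (q + r * \<beta>) * (x - mx) + k * \<beta> * (x - mx)\<^sup>2) \<partial>?L) = p + k * \<beta> * (sqrt vx)\<^sup>2"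
    unfolding N_def by (rule integral_normal_quadratic[OF sx])
  also have "k * \<beta> * (sqrt vx)\<^sup>2 = k * (\<rho> * sqrt vx * sqrt vy)"
    using sx unfolding \<beta>_def power2_eq_square by (simp add: field_simps)
  finally have "has_bochner_integral (?L \<Otimes>\<^sub>M ?L) (\<lambda>z. f (fst z) (snd z) * h z) (p + k * (\<rho> * sqrt vx * sqrt vy))"
    using int by (simp add: has_bochner_integral_iff)
  then show ?thesis unfolding lborel_prod f_def h_def case_prod_beta .
qed

text \<open>All three integrals are instances of \<open>has_bochner_integral_g1\<close>: each
  coordinate as its mean plus a centred coordinate, then the product of the centred
  coordinates.\<close>

lemma sigma_xy_eq:
  assumes "\<tau> \<in> param_space"
  shows "sigma_xy \<tau> = rho \<tau> * sqrt (var_x \<tau>) * sqrt (var_y \<tau>)"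
proof -
  have v: "var_x \<tau> > 0" "var_y \<tau> > 0" "\<bar>rho \<tau>\<bar> < 1" using assms by (auto simp: param_space_def)
  let ?mx = "mu_x \<tau>" and ?my = "mu_y \<tau>"
  define f where "f = (\<lambda>(x, y). g1 x y ?mx ?my (var_x \<tau>) (var_y \<tau>) (rho \<tau>))"
  have fm: "f \<in> borel_measurable lborel"
    using g1_measurable unfolding f_def lborel_prod .
  have fn: "0 \<le> f z" for z
    unfolding f_def by (cases z) (simp add: g1_factorization[OF v])
  have M: "internal_means_distr \<tau> = density lborel (\<lambda>z. ennreal (f z))"
    unfolding internal_means_distr_def f_def
    by (intro arg_cong[where f = "density lborel"] ext) (simp split: prod.split)
  have [measurable]: "(fst :: real \<times> real \<Rightarrow> real) \<in> borel_measurable borel"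
      "(snd :: real \<times> real \<Rightarrow> real) \<in> borel_measurable borel"
    by (intro borel_measurable_continuous_onI continuous_on_fst continuous_on_snd continuous_on_id)+
  have E: "(LINT z|internal_means_distr \<tau>. g z) = (LINT z|lborel. f z * g z)"
    if "g \<in> borel_measurable lborel" for g :: "real \<times> real \<Rightarrow> real"
    unfolding M using that fm fn by (subst integral_density) auto
  have I: "(LINT z|lborel. f z * (p + q * (fst z - ?mx) + r * (snd z - ?my) + k * ((fst z - ?mx) * (snd z - ?my))))
      = p + k * (rho \<tau> * sqrt (var_x \<tau>) * sqrt (var_y \<tau>))" for p q r k
    using has_bochner_integral_integral_eq[OF has_bochner_integral_g1[OF v, of ?mx ?my p q r k]]
    by (simp add: f_def case_prod_unfold)
  have "(LINT z|internal_means_distr \<tau>. fst z) = ?mx"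
    using I[of ?mx 1 0 0] by (subst E) auto
  moreover have "(LINT z|internal_means_distr \<tau>. snd z) = ?my"
    using I[of ?my 0 1 0] by (subst E) auto
  ultimately show ?thesis
    unfolding sigma_xy_def covariance_def using I[of 0 0 0 1] by (simp add: E)
qed

text \<open>Collinear internal means, which include every sample with \<open>n \<le> 2\<close>,
  admit no maximiser. Hence any maximiser is identified unconditionally, while existence is asserted
  for noncollinear samples.\<close>

theorem mainTheorem1:
  fixes \<nu> :: real and n :: nat and x y s t r :: "nat \<Rightarrow> real"
  assumes "\<nu> > 2"
    and "n \<ge> 1"
    and "\<And>i. i \<in> {1..n} \<Longrightarrow> (s i, t i, r i) \<in> wishart_support"
  shows "(\<forall>\<tau>. is_mle \<nu> n x y s t r \<tau> \<longrightarrow>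
            \<tau> = tau_hat \<nu> n x y s t r \<and>
            rho \<tau> = sigma_xy_hat n x y / (sqrt (var_x \<tau>) * sqrt (var_y \<tau>)) \<and>
            sigma_xy \<tau> = sigma_xy_hat n x y) \<and>
         (\<not> collinear ((\<lambda>i. (x i, y i)) ` {1..n}) \<longrightarrow>
            is_mle \<nu> n x y s t r (tau_hat \<nu> n x y s t r))"
proof (intro conjI allI impI)
  let ?T = "tau_hat \<nu> n x y s t r"
  have iff: "is_mle \<nu> n x y s t r \<tau> \<longleftrightarrow> \<tau> \<in> param_space \<and>
      (\<forall>\<tau>'\<in>param_space. deviance \<nu> n x y s t r \<tau> \<le> deviance \<nu> n x y s t r \<tau>')" for \<tau>
    by (rule is_mle_iff_deviance[OF assms])
  {
    fix \<tau> assume mle: "is_mle \<nu> n x y s t r \<tau>"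
    \<comment> \<open>Existence of a maximiser excludes the singular case, so \<open>tau_hat\<close>
      is itself an admissible competitor and uniqueness applies.\<close>
    have lt: "(sigma_xy_hat n x y)\<^sup>2 < var_x ?T * var_y ?T"
      by (rule mle_imp_nondegenerate[OF assms mle])
    have T: "?T \<in> param_space" by (rule tau_hat_in_param_space[OF assms lt])
    have \<tau>: "\<tau> \<in> param_space" and le: "deviance \<nu> n x y s t r \<tau> \<le> deviance \<nu> n x y s t r ?T"
      using mle T unfolding iff by auto
    show eq: "\<tau> = ?T" by (rule deviance_tau_hat(2)[OF assms lt \<tau> le])
    show "rho \<tau> = sigma_xy_hat n x y / (sqrt (var_x \<tau>) * sqrt (var_y \<tau>))"
      unfolding eq by (rule rho_tau_hat[OF assms(2)])
    have "sigma_xy ?T = cov_param ?T" unfolding cov_param_def by (rule sigma_xy_eq[OF T])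
    then show "sigma_xy \<tau> = sigma_xy_hat n x y"
      unfolding eq using cov_param_tau_hat[OF assms(2) lt] by simp
  }
  assume "\<not> collinear ((\<lambda>i. (x i, y i)) ` {1..n})"
  then have lt: "(sigma_xy_hat n x y)\<^sup>2 < var_x ?T * var_y ?T"
    by (rule noncollinear_imp_nondegenerate[OF assms(2)])
  show "is_mle \<nu> n x y s t r ?T"
    unfolding iff
  proof (intro conjI ballI)
    show "?T \<in> param_space" by (rule tau_hat_in_param_space[OF assms lt])
    show "deviance \<nu> n x y s t r ?T \<le> deviance \<nu> n x y s t r \<tau>" if "\<tau> \<in> param_space" for \<tau>
      by (rule deviance_tau_hat(1)[OF assms lt that])
  qed
qed

end
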